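(* Let $\mathscr{X}$ be a Hilbert $\mathscr{A}$-module and $x, y \in \mathscr{X}$. Then the following conditions are equivalent: (i) $\forall_{a\in \mathscr{A}}\ |xa + y|^2 \geq |xa|^2$; (ii) $\forall_{a\in \mathscr{A}}\ |xa + y| \geq |xa|$; (iii) $\forall_{a\in \mathscr{A}}\ \|xa + y\| \geq \|xa\|$; (iv) $x\perp y$, i.e. $\langle x, y\rangle = 0$. Moreover, each of the conditions (i)–(iv) is equivalent to each of the following three: (v) $\forall_{a\in \mathscr{A}}\ |ya + x|^2 \geq |ya|^2$; (vi) $\forall_{a\in \mathscr{A}}\ |ya + x| \geq |ya|$; (vii) $\forall_{a\in \mathscr{A}}\ \|ya + x\| \geq \|ya\|$.
   Context: $\mathscr{A}$ is a $C^*$-algebra and $\mathscr{X}$ is a (right) Hilbert $\mathscr{A}$-module with $\mathscr{A}$-valued inner product $\langle\cdot,\cdot\rangle$ (linear and $\mathscr{A}$-linear in the second variable, $\langle x, y\rangle=\langle y, x\rangle^*$), complete with respect to the norm $\|x\| = \sqrt{\|\langle x, x\rangle\|}$. For $z\in\mathscr{X}$, $|z|$ denotes the unique positive square root of $\langle z, z\rangle\in\mathscr{A}$. Inequalities between elements of $\mathscr{A}$ refer to the order $a\geq b \iff a-b$ is positive (of the form $c^*c$). The relation $x\perp y$ means $\langle x, y\rangle = 0$; it is symmetric. *)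

theory Defs
  imports "HOL-Analysis.Analysis"
begin

text \<open>
  A C*-algebra is modelled as a type 'a carrying a (not necessarily unital)
  real Banach algebra structure (type classes real_normed_algebra and banach),
  together with an explicit complex scalar multiplication sc and an
  involution st, subject to the C*-algebra axioms.
\<close>

definition complex_scalar :: "(complex \<Rightarrow> 'v::ab_group_add \<Rightarrow> 'v) \<Rightarrow> bool" where
  "complex_scalar sc \<longleftrightarrow>
     (\<forall>c d v. sc (c + d) v = sc c v + sc d v) \<and>
     (\<forall>c v w. sc c (v + w) = sc c v + sc c w) \<and>
     (\<forall>c d v. sc (c * d) v = sc c (sc d v)) \<and>
     (\<forall>v. sc 1 v = v)"

definition cstar_algebra ::
  "(complex \<Rightarrow> 'a::{real_normed_algebra,banach} \<Rightarrow> 'a) \<Rightarrow> ('a \<Rightarrow> 'a) \<Rightarrow> bool" where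
  "cstar_algebra sc st \<longleftrightarrow>
     complex_scalar sc \<and>
     (\<forall>r a. sc (complex_of_real r) a = scaleR r a) \<and>
     (\<forall>c a b. sc c (a * b) = sc c a * b \<and> sc c (a * b) = a * sc c b) \<and>
     (\<forall>c a. norm (sc c a) = cmod c * norm a) \<and>
     (\<forall>a. st (st a) = a) \<and>
     (\<forall>a b. st (a + b) = st a + st b) \<and>
     (\<forall>c a. st (sc c a) = sc (cnj c) (st a)) \<and>
     (\<forall>a b. st (a * b) = st b * st a) \<and>
     (\<forall>a. norm (st a * a) = (norm a)\<^sup>2)"

definition cpos :: "('a::ring \<Rightarrow> 'a) \<Rightarrow> 'a \<Rightarrow> bool" where
  "cpos st a \<longleftrightarrow> (\<exists>c. a = st c * c)"

definition cle :: "('a::ring \<Rightarrow> 'a) \<Rightarrow> 'a \<Rightarrow> 'a \<Rightarrow> bool" where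
  "cle st a b \<longleftrightarrow> cpos st (b - a)"

definition hnorm :: "('x \<Rightarrow> 'x \<Rightarrow> 'a::real_normed_vector) \<Rightarrow> 'x \<Rightarrow> real" where
  "hnorm ip x = sqrt (norm (ip x x))"

definition hilbert_module ::
  "(complex \<Rightarrow> 'a::{real_normed_algebra,banach} \<Rightarrow> 'a) \<Rightarrow> ('a \<Rightarrow> 'a) \<Rightarrow>
   (complex \<Rightarrow> 'x::ab_group_add \<Rightarrow> 'x) \<Rightarrow> ('x \<Rightarrow> 'a \<Rightarrow> 'x) \<Rightarrow> ('x \<Rightarrow> 'x \<Rightarrow> 'a) \<Rightarrow> bool" where
  "hilbert_module sc st scX act ip \<longleftrightarrow>
     cstar_algebra sc st \<and>
     complex_scalar scX \<and>
     (\<forall>x y a. act (x + y) a = act x a + act y a) \<and>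
     (\<forall>x a b. act x (a + b) = act x a + act x b) \<and>
     (\<forall>x a b. act x (a * b) = act (act x a) b) \<and>
     (\<forall>c x a. scX c (act x a) = act (scX c x) a \<and> scX c (act x a) = act x (sc c a)) \<and>
     (\<forall>x y z. ip x (y + z) = ip x y + ip x z) \<and>
     (\<forall>c x y. ip x (scX c y) = sc c (ip x y)) \<and>
     (\<forall>x y a. ip x (act y a) = ip x y * a) \<and>
     (\<forall>x y. ip y x = st (ip x y)) \<and>
     (\<forall>x. cpos st (ip x x)) \<and>
     (\<forall>x. ip x x = 0 \<longrightarrow> x = 0) \<and>
     (\<forall>f. (\<forall>e::real>0. \<exists>N::nat. \<forall>m\<ge>N. \<forall>n\<ge>N. hnorm ip (f m - f n) < e) \<longrightarrow>
          (\<exists>l. \<forall>e::real>0. \<exists>N::nat. \<forall>n\<ge>N. hnorm ip (f n - l) < e))"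

definition habs :: "('a::ring \<Rightarrow> 'a) \<Rightarrow> ('x \<Rightarrow> 'x \<Rightarrow> 'a) \<Rightarrow> 'x \<Rightarrow> 'a" where
  "habs st ip z = (THE b. cpos st b \<and> b * b = ip z z)"

end

theory Submission
  imports Defs
begin

text \<open>
  Condition (iv) gives \<open>\<bar>xa + y\<bar>\<^sup>2 = \<bar>xa\<bar>\<^sup>2 + \<bar>y\<bar>\<^sup>2\<close>, hence (i), and (ii) because the square root is
  operator monotone; (i) and (ii) give (iii) because the norm is monotone on positive elements.
  If (iii) holds, put \<open>p = \<langle>x, y\<rangle>\<close> and \<open>a = - r p\<close> with \<open>r > 0\<close> large. As
  \<open>T = p\<^sup>* \<bar>x\<bar>\<^sup>2 p \<le> M p\<^sup>* p\<close> for some \<open>M > 0\<close>, one gets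
  \<open>\<bar>xa + y\<bar>\<^sup>2 \<le> (r\<^sup>2 - 2 r / M) T + \<bar>y\<bar>\<^sup>2\<close>, so that \<open>2 r \<parallel>T\<parallel> \<le> M \<parallel>y\<parallel>\<^sup>2\<close> for all large \<open>r\<close>. Hence
  \<open>T = 0\<close>, that is \<open>xp = 0\<close>, and \<open>p\<^sup>* p = \<langle>y, xp\<rangle> = 0\<close>.

  The order theory of \<open>\<A>\<close> is obtained without spectral theory. An element \<open>a\<close> is called
  positive if it is selfadjoint and \<open>\<parallel>t - a\<parallel> \<le> t\<close> for some \<open>t \<ge> 0\<close>, the norm being that of left
  multiplication on \<open>\<A>\<close>; such elements form a convex cone. Square roots come from the
  iteration \<open>y \<mapsto> (u + y\<^sup>2) / 2\<close>, whose limit \<open>y\<close> satisfies \<open>(1 - y)\<^sup>2 = 1 - u\<close> if \<open>\<parallel>u\<parallel> \<le> 1\<close>.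
\<close>

section \<open>The square root iteration\<close>

text \<open>The iterates of y -> (u + y^2) / 2 for u = \<alpha> + b are kept as pairs of a scalar r
  and an algebra element k, since (r + k)^2 has scalar part r^2 and algebra part 2 r k + k^2.
  \<open>visser_op\<close> is left multiplication by r + k; its operator norm serves as the norm of
  the pair.\<close>

primrec visser_r :: "real \<Rightarrow> nat \<Rightarrow> real" where
  "visser_r \<alpha> 0 = 0"
| "visser_r \<alpha> (Suc n) = (\<alpha> + (visser_r \<alpha> n)\<^sup>2) / 2"

primrec visser_k :: "real \<Rightarrow> 'a::real_normed_algebra \<Rightarrow> nat \<Rightarrow> 'a" where
  "visser_k \<alpha> b 0 = 0"
| "visser_k \<alpha> b (Suc n) =
     (1/2) *\<^sub>R (b + (2 * visser_r \<alpha> n) *\<^sub>R visser_k \<alpha> b n + visser_k \<alpha> b n * visser_k \<alpha> b n)"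

definition visser_op :: "real \<Rightarrow> 'a::real_normed_algebra \<Rightarrow> nat \<Rightarrow> 'a \<Rightarrow> 'a" where
  "visser_op \<alpha> b n x = visser_r \<alpha> n *\<^sub>R x + visser_k \<alpha> b n * x"

lemma visser_r_bounds:
  assumes "0 \<le> \<alpha>" "\<alpha> \<le> 1"
  shows "0 \<le> visser_r \<alpha> n \<and> visser_r \<alpha> n \<le> 1"
proof (induction n)
  case (Suc n)
  then have "(visser_r \<alpha> n)\<^sup>2 \<le> 1" by (simp add: power_le_one)
  with Suc assms show ?case by simp
qed simp

lemma visser_r_mono:
  assumes "0 \<le> \<alpha>" "\<alpha> \<le> 1"
  shows "visser_r \<alpha> n \<le> visser_r \<alpha> (Suc n)"
proof (induction n)
  case (Suc n)
  then have "(visser_r \<alpha> n)\<^sup>2 \<le> (visser_r \<alpha> (Suc n))\<^sup>2"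
    using visser_r_bounds[OF assms] by (intro power_mono) auto
  then show ?case by simp
qed (use assms in simp)

lemma visser_r_tendsto:
  assumes "0 \<le> \<alpha>" "\<alpha> \<le> 1"
  obtains r where "visser_r \<alpha> \<longlonglongrightarrow> r" "0 \<le> r" "r \<le> 1" "r\<^sup>2 + \<alpha> = 2 * r"
proof -
  have "incseq (visser_r \<alpha>)"
    using visser_r_mono[OF assms] by (rule incseq_SucI)
  then obtain r where r: "visser_r \<alpha> \<longlonglongrightarrow> r"
    using incseq_convergent[of "visser_r \<alpha>" 1] visser_r_bounds[OF assms] by blast
  have "(\<lambda>n. visser_r \<alpha> (Suc n)) \<longlonglongrightarrow> (\<alpha> + r\<^sup>2) / 2"
    unfolding visser_r.simps by (intro tendsto_intros r) simp
  then have "(\<alpha> + r\<^sup>2) / 2 = r"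
    using LIMSEQ_Suc[OF r] LIMSEQ_unique by blast
  moreover have "0 \<le> r" "r \<le> 1"
    using LIMSEQ_le_const[OF r] LIMSEQ_le_const2[OF r] visser_r_bounds[OF assms] by blast+
  ultimately show thesis using that r by simp
qed

lemma visser_k_commute:
  assumes "c * b = b * c"
  shows "c * visser_k \<alpha> b n = visser_k \<alpha> b n * c"
proof (induction n)
  case (Suc n)
  have "c * (visser_k \<alpha> b n * visser_k \<alpha> b n) = visser_k \<alpha> b n * visser_k \<alpha> b n * c"
    by (metis Suc mult.assoc)
  then show ?case
    using Suc assms by (simp add: distrib_left distrib_right)
qed simp

lemma visser_op_Suc:
  "visser_op \<alpha> b (Suc n) x = (1/2) *\<^sub>R (\<alpha> *\<^sub>R x + b * x + visser_op \<alpha> b n (visser_op \<alpha> b n x))"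
  by (simp add: visser_op_def algebra_simps power2_eq_square flip: scaleR_add_left)

lemma visser_op_add: "visser_op \<alpha> b n (x + y) = visser_op \<alpha> b n x + visser_op \<alpha> b n y"
  by (simp add: visser_op_def algebra_simps)

lemma visser_op_commute:
  "visser_op \<alpha> b m (visser_op \<alpha> b n x) = visser_op \<alpha> b n (visser_op \<alpha> b m x)"
proof -
  have "visser_k \<alpha> b m * visser_k \<alpha> b n = visser_k \<alpha> b n * visser_k \<alpha> b m"
    by (intro visser_k_commute visser_k_commute[symmetric] refl)
  then have "visser_k \<alpha> b m * (visser_k \<alpha> b n * x) = visser_k \<alpha> b n * (visser_k \<alpha> b m * x)"
    by (metis mult.assoc)
  then show ?thesis by (simp add: visser_op_def algebra_simps)
qed

text \<open>The scalar iteration with u = 1 is a majorant: if u and y have norms at most 1 and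
  \<rho>, the next iterate has norm at most (1 + \<rho>^2) / 2.\<close>

lemma norm_visser_op:
  assumes "\<And>x. norm (\<alpha> *\<^sub>R x + b * x) \<le> norm x"
  shows "norm (visser_op \<alpha> b n x) \<le> visser_r 1 n * norm x"
proof (induction n arbitrary: x)
  case (Suc n)
  let ?r = "visser_r 1 n"
  have r: "0 \<le> ?r" using visser_r_bounds[of 1] by simp
  have "norm (visser_op \<alpha> b n (visser_op \<alpha> b n x)) \<le> ?r * (?r * norm x)"
    by (rule order_trans[OF Suc mult_left_mono[OF Suc r]])
  then have "norm (\<alpha> *\<^sub>R x + b * x + visser_op \<alpha> b n (visser_op \<alpha> b n x)) \<le> norm x + ?r * (?r * norm x)"
    by (intro norm_triangle_mono assms)
  then show ?case
    unfolding visser_op_Suc norm_scaleR by (simp add: field_simps power2_eq_square)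
qed (simp add: visser_op_def)

lemma norm_visser_op_step:
  assumes "\<And>x. norm (\<alpha> *\<^sub>R x + b * x) \<le> norm x"
  shows "norm (visser_op \<alpha> b (Suc n) x - visser_op \<alpha> b n x)
           \<le> (visser_r 1 (Suc n) - visser_r 1 n) * norm x"
proof (induction n arbitrary: x)
  case 0
  show ?case unfolding visser_op_Suc using assms by (simp add: visser_op_def)
next
  case (Suc n)
  let ?Y = "visser_op \<alpha> b"
  let ?r = "visser_r 1"
  let ?z = "?Y (Suc n) x + ?Y n x"
  have d: "0 \<le> ?r (Suc n) - ?r n" using visser_r_mono[of 1 n] by simp
  \<comment> \<open>Iterates commute, so a difference of squares factors into difference times sum.
    The induction hypothesis bounds the first factor, \<open>norm_visser_op\<close> the second, and
    the majorant obeys the same identity.\<close>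
  have "?Y (Suc (Suc n)) x - ?Y (Suc n) x = (1/2) *\<^sub>R (?Y (Suc n) (?Y (Suc n) x) - ?Y n (?Y n x))"
    by (subst visser_op_Suc, subst (3) visser_op_Suc) (simp add: algebra_simps)
  also have "?Y (Suc n) (?Y (Suc n) x) - ?Y n (?Y n x) = ?Y (Suc n) ?z - ?Y n ?z"
    by (simp add: visser_op_add visser_op_commute[of \<alpha> b n "Suc n"])
  finally have "norm (?Y (Suc (Suc n)) x - ?Y (Suc n) x) = norm (?Y (Suc n) ?z - ?Y n ?z) / 2"
    by simp
  also have "\<dots> \<le> (?r (Suc n) - ?r n) * norm ?z / 2"
    using Suc[of ?z] by simp
  also have "\<dots> \<le> (?r (Suc n) - ?r n) * (?r (Suc n) * norm x + ?r n * norm x) / 2"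
    using norm_triangle_mono[OF norm_visser_op[OF assms, of "Suc n" x] norm_visser_op[OF assms, of n x]]
      mult_left_mono[OF _ d] by simp
  also have "\<dots> = (?r (Suc (Suc n)) - ?r (Suc n)) * norm x"
    by (simp add: field_simps power2_eq_square)
  finally show ?case .
qed

lemma norm_visser_op_diff:
  assumes "\<And>x. norm (\<alpha> *\<^sub>R x + b * x) \<le> norm x" and "n \<le> m"
  shows "norm (visser_op \<alpha> b m x - visser_op \<alpha> b n x) \<le> (visser_r 1 m - visser_r 1 n) * norm x"
  using \<open>n \<le> m\<close>
proof (induction m rule: dec_induct)
  case (step m)
  have "norm (visser_op \<alpha> b (Suc m) x - visser_op \<alpha> b n x)
      \<le> norm (visser_op \<alpha> b (Suc m) x - visser_op \<alpha> b m x) + norm (visser_op \<alpha> b m x - visser_op \<alpha> b n x)"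
    by (rule norm_diff_triangle_le[OF order_refl order_refl])
  also have "\<dots> \<le> (visser_r 1 (Suc m) - visser_r 1 m) * norm x + (visser_r 1 m - visser_r 1 n) * norm x"
    by (intro add_mono norm_visser_op_step assms(1) step.IH)
  finally show ?case by (simp add: algebra_simps)
qed simp

text \<open>The orbit of \<kappa> -> \<kappa> q + c converges to the fixed point c / (1 - q), which
  lies below \<eta>.\<close>

lemma affine_contraction_below:
  fixes S :: "real set"
  assumes "\<kappa>0 \<in> S" "0 \<le> \<kappa>0" "0 < q" "q < 1" "0 \<le> c"
    and step: "\<And>\<kappa>. \<kappa> \<in> S \<Longrightarrow> 0 \<le> \<kappa> \<Longrightarrow> \<kappa> * q + c \<in> S"
    and "c < \<eta> * (1 - q)"
  shows "\<exists>\<kappa>\<in>S. 0 \<le> \<kappa> \<and> \<kappa> < \<eta>"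
proof -
  define L where "L = c / (1 - q)"
  have L: "L * q + c = L" using \<open>q < 1\<close> by (simp add: L_def field_simps)
  have "L + q ^ n * (\<kappa>0 - L) \<in> S \<and> 0 \<le> L + q ^ n * (\<kappa>0 - L)" for n
  proof (induction n)
    case (Suc n)
    have "L + q ^ Suc n * (\<kappa>0 - L) = (L + q ^ n * (\<kappa>0 - L)) * q + c"
      by (subst L[symmetric]) (simp add: algebra_simps)
    moreover have "0 \<le> (L + q ^ n * (\<kappa>0 - L)) * q + c"
      using mult_nonneg_nonneg[OF conjunct2[OF Suc], of q] \<open>0 < q\<close> \<open>0 \<le> c\<close> by linarith
    ultimately show ?case using step Suc by metis
  qed (simp add: assms(1,2))
  note in_S = this
  have "(\<lambda>n. L + q ^ n * (\<kappa>0 - L)) \<longlonglongrightarrow> L + 0 * (\<kappa>0 - L)"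
    using \<open>0 < q\<close> \<open>q < 1\<close> by (intro tendsto_intros LIMSEQ_power_zero) simp
  moreover have "L + 0 * (\<kappa>0 - L) < \<eta>" using \<open>q < 1\<close> \<open>c < \<eta> * (1 - q)\<close>
    by (simp add: L_def divide_less_eq)
  ultimately have "\<exists>n. L + q ^ n * (\<kappa>0 - L) < \<eta>"
    using order_tendstoD(2) eventually_happens'[OF sequentially_bot] by blast
  then show ?thesis using in_S by blast
qed

section \<open>Positive elements of a C*-algebra\<close>

locale cstar =
  fixes sc :: "complex \<Rightarrow> 'a::{real_normed_algebra,banach} \<Rightarrow> 'a"
    and st :: "'a \<Rightarrow> 'a"
  assumes cstar: "cstar_algebra sc st"
begin

section \<open>Involution and norm identities\<close>

lemma sc_of_real: "sc (complex_of_real r) a = r *\<^sub>R a"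
  and sc_mult_left: "sc c (a * b) = sc c a * b"
  and sc_mult_right: "sc c (a * b) = a * sc c b"
  and st_st [simp]: "st (st a) = a"
  and st_add: "st (a + b) = st a + st b"
  and st_sc: "st (sc c a) = sc (cnj c) (st a)"
  and st_mult: "st (a * b) = st b * st a"
  and norm_st_mult_self: "norm (st a * a) = (norm a)\<^sup>2"
  and sc_add_right: "sc c (a + b) = sc c a + sc c b"
  and sc_sc: "sc c (sc d a) = sc (c * d) a"
  using cstar unfolding cstar_algebra_def complex_scalar_def by metis+

lemma st_scaleR: "st (r *\<^sub>R a) = r *\<^sub>R st a"
  using st_sc[of "complex_of_real r" a] by (simp add: sc_of_real)

lemma st_zero [simp]: "st 0 = 0"
  using st_scaleR[of 0 0] by simp

lemma st_minus: "st (- a) = - st a"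
  using st_scaleR[of "-1" a] by simp

lemma st_diff: "st (a - b) = st a - st b"
  using st_add[of a "- b"] by (simp add: st_minus)

lemmas st_simps = st_add st_mult st_scaleR st_minus st_diff

lemma sc_minus_i: "sc (- \<i>) a = - sc \<i> a"
proof -
  have "sc (- \<i>) a = sc (complex_of_real (-1)) (sc \<i> a)"
    by (simp add: sc_sc)
  then show ?thesis by (simp only: sc_of_real) simp
qed

lemma sc_i_i: "sc \<i> (sc \<i> a) = - a"
proof -
  have "sc \<i> (sc \<i> a) = sc (complex_of_real (-1)) a"
    by (simp add: sc_sc)
  then show ?thesis by (simp only: sc_of_real) simp
qed

lemma sc_minus: "sc c (- a) = - sc c a"
  using sc_add_right[of c 0 0] sc_add_right[of c a "- a"] by (simp add: eq_neg_iff_add_eq_0 add.commute)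

lemma sc_diff: "sc c (a - b) = sc c a - sc c b"
  using sc_add_right[of c a "- b"] by (simp add: sc_minus)

lemma st_sc_i: "st (sc \<i> a) = - sc \<i> (st a)"
  by (simp add: st_sc sc_minus_i)

lemma norm_st [simp]: "norm (st a) = norm a"
proof -
  have le: "norm b \<le> norm (st b)" for b
  proof (cases "b = 0")
    case False
    have "norm b * norm b \<le> norm (st b) * norm b"
      using norm_st_mult_self[of b] norm_mult_ineq[of "st b" b] by (simp add: power2_eq_square)
    with False show ?thesis by simp
  qed simp
  from le[of a] le[of "st a"] show ?thesis by simp
qed

lemma norm_mult_st_self: "norm (a * st a) = (norm a)\<^sup>2"
  using norm_st_mult_self[of "st a"] by simp

lemma norm_square_selfadjoint: "st a = a \<Longrightarrow> norm (a * a) = (norm a)\<^sup>2"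
  using norm_st_mult_self[of a] by simp

lemma st_mult_self_eq_0: "st a * a = 0 \<longleftrightarrow> a = 0"
  using norm_st_mult_self[of a] by auto

text \<open>Test at x = \<open>st a\<close> and use the C*-identity. This turns bounds on left
  multiplication into bounds in the algebra.\<close>

lemma norm_le_multiplier_bound:
  fixes a :: 'a
  assumes "\<And>x. norm (a * x) \<le> M * norm x" and "0 \<le> M"
  shows "norm a \<le> M"
proof (cases "a = 0")
  case False
  have "norm a * norm a \<le> M * norm a"
    using assms(1)[of "st a"] norm_mult_st_self[of a] by (simp add: power2_eq_square)
  with False show ?thesis by simp
qed (simp add: assms)

lemma tendsto_st:
  assumes "f \<longlonglongrightarrow> l"
  shows "(\<lambda>n. st (f n)) \<longlonglongrightarrow> st l"
proof -
  have "(\<lambda>n. norm (f n - l)) \<longlonglongrightarrow> 0"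
    using assms by (simp add: tendsto_norm_zero_iff LIM_zero_iff)
  then have "(\<lambda>n. norm (st (f n) - st l)) \<longlonglongrightarrow> 0"
    by (simp flip: st_diff)
  then show ?thesis by (simp add: tendsto_norm_zero_iff LIM_zero_iff)
qed

lemma st_visser_k: "st b = b \<Longrightarrow> st (visser_k \<alpha> b n) = visser_k \<alpha> b n"
  by (induction n) (simp_all add: st_simps)


text \<open>The limit of the iteration is y = r + k; the equations for r and k are the scalar and
  the algebra part of u + y^2 = 2 y.\<close>

lemma visser_limit:
  fixes b :: 'a
  assumes \<alpha>: "0 \<le> \<alpha>" "\<alpha> \<le> 1" and sa: "st b = b"
    and contr: "\<And>x. norm (\<alpha> *\<^sub>R x + b * x) \<le> norm x"
  obtains r k where "0 \<le> r" "r \<le> 1" "r\<^sup>2 + \<alpha> = 2 * r"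
    "b + (2 * r) *\<^sub>R k + k * k = 2 *\<^sub>R k" "st k = k"
    "\<And>c. c * b = b * c \<Longrightarrow> c * k = k * c"
    "\<And>x. norm (r *\<^sub>R x + k * x) \<le> norm x"
proof -
  let ?Y = "visser_op \<alpha> b" and ?k = "visser_k \<alpha> b"
  obtain r where r: "visser_r \<alpha> \<longlonglongrightarrow> r" "0 \<le> r" "r \<le> 1" "r\<^sup>2 + \<alpha> = 2 * r"
    using visser_r_tendsto[OF \<alpha>] by blast
  obtain \<rho> where \<rho>: "visser_r 1 \<longlonglongrightarrow> \<rho>"
    using visser_r_tendsto[of 1] by auto
  \<comment> \<open>The difference of two algebra parts is the difference of the full iterates minus
    that of their scalar parts. Each is controlled by a convergent increasing scalar sequence;
    \<open>\<sigma>\<close> is the sum of the two.\<close>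
  define \<sigma> where "\<sigma> n = visser_r 1 n + visser_r \<alpha> n" for n
  have \<sigma>_mono: "mono \<sigma>"
    unfolding \<sigma>_def using visser_r_mono[of 1] visser_r_mono[OF \<alpha>]
    by (intro incseq_SucI add_mono) auto
  have step: "norm (?k m - ?k n) \<le> \<sigma> m - \<sigma> n" if "n \<le> m" for m n
  proof (rule norm_le_multiplier_bound)
    fix x
    have "(?k m - ?k n) * x
        = (?Y m x - ?Y n x) + (- (visser_r \<alpha> m - visser_r \<alpha> n)) *\<^sub>R x"
      by (simp add: visser_op_def algebra_simps)
    also have "norm \<dots> \<le> (visser_r 1 m - visser_r 1 n) * norm x
        + (visser_r \<alpha> m - visser_r \<alpha> n) * norm x"
    proof (rule norm_triangle_mono[OF norm_visser_op_diff[OF contr that]])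
      have "visser_r \<alpha> n \<le> visser_r \<alpha> m"
        using that visser_r_mono[OF \<alpha>] by (metis lift_Suc_mono_le)
      then show "norm ((- (visser_r \<alpha> m - visser_r \<alpha> n)) *\<^sub>R x)
          \<le> (visser_r \<alpha> m - visser_r \<alpha> n) * norm x" by simp
    qed
    finally show "norm ((?k m - ?k n) * x) \<le> (\<sigma> m - \<sigma> n) * norm x"
      by (simp add: \<sigma>_def algebra_simps)
  qed (use \<sigma>_mono that in \<open>simp add: monoD\<close>)
  have "Cauchy \<sigma>"
    unfolding \<sigma>_def by (rule LIMSEQ_imp_Cauchy, rule tendsto_add[OF \<rho> r(1)])
  have "Cauchy ?k"
  proof (rule metric_CauchyI)
    fix e :: real assume "0 < e"
    with \<open>Cauchy \<sigma>\<close> obtain M where M: "\<And>m n. M \<le> m \<Longrightarrow> M \<le> n \<Longrightarrow> dist (\<sigma> m) (\<sigma> n) < e"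
      by (meson metric_CauchyD)
    have "dist (?k m) (?k n) < e" if "M \<le> n" "n \<le> m" for m n
      using step[OF that(2)] M[of m n] that by (simp add: dist_norm)
    then show "\<exists>M. \<forall>m\<ge>M. \<forall>n\<ge>M. dist (?k m) (?k n) < e"
      by (metis dist_commute nle_le)
  qed
  then obtain k where k: "?k \<longlonglongrightarrow> k"
    using Cauchy_convergent_iff convergent_def by blast
  have "(\<lambda>n. ?k (Suc n)) \<longlonglongrightarrow> (1/2) *\<^sub>R (b + (2 * r) *\<^sub>R k + k * k)"
    unfolding visser_k.simps by (intro tendsto_intros k r)
  then have "(1/2) *\<^sub>R (b + (2 * r) *\<^sub>R k + k * k) = k"
    using LIMSEQ_Suc[OF k] LIMSEQ_unique by blast
  then have eq: "b + (2 * r) *\<^sub>R k + k * k = 2 *\<^sub>R k"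
    by (metis (no_types, lifting) divide_self_if scaleR_one scaleR_scaleR times_divide_eq_right
        mult.right_neutral zero_neq_numeral)
  have "(\<lambda>n. ?k n) \<longlonglongrightarrow> st k"
    using tendsto_st[OF k] by (simp add: st_visser_k[OF sa])
  then have st_k: "st k = k" using k by (rule LIMSEQ_unique)
  have comm: "c * k = k * c" if "c * b = b * c" for c
  proof -
    have "(\<lambda>n. c * ?k n) \<longlonglongrightarrow> c * k" "(\<lambda>n. ?k n * c) \<longlonglongrightarrow> k * c"
      by (intro tendsto_intros k)+
    then show ?thesis
      unfolding visser_k_commute[OF that] by (rule LIMSEQ_unique)
  qed
  have "norm (r *\<^sub>R x + k * x) \<le> norm x" for x
  proof (rule LIMSEQ_le_const2)
    show "(\<lambda>n. norm (?Y n x)) \<longlonglongrightarrow> norm (r *\<^sub>R x + k * x)"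
      unfolding visser_op_def by (intro tendsto_intros k r)
    have "norm (?Y n x) \<le> norm x" for n
      by (rule order_trans[OF norm_visser_op[OF contr]])
        (use visser_r_bounds[of 1 n] in \<open>simp add: mult_left_le_one_le\<close>)
    then show "\<exists>N. \<forall>n\<ge>N. norm (?Y n x) \<le> norm x" by blast
  qed
  with that r eq st_k comm show thesis by blast
qed

text \<open>A pair of a real number \<open>\<beta>\<close> and an element \<open>a\<close> stands for \<open>\<beta> + a\<close> in the unitization.
  The lemma takes the square root of \<open>\<beta> + a\<close>, obtained as \<open>\<surd>t (1 - y)\<close> where \<open>y\<close> is the limit
  of the iteration \<open>y \<mapsto> (u + y\<^sup>2) / 2\<close> for \<open>u = 1 - (\<beta> + a) / t\<close>.\<close>
lemma unitized_sqrt: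
  fixes a :: 'a
  assumes \<beta>: "0 \<le> \<beta>" "\<beta> \<le> t" and sa: "st a = a"
    and contr: "\<And>x. norm (t *\<^sub>R x - \<beta> *\<^sub>R x - a * x) \<le> t * norm x"
  obtains \<rho> k where "0 \<le> \<rho>" "\<rho>\<^sup>2 = \<beta>" "k * k + (2 * \<rho>) *\<^sub>R k = a" "st k = k"
    "\<And>c. c * a = a * c \<Longrightarrow> c * k = k * c"
    "\<And>x. norm (sqrt t *\<^sub>R x - \<rho> *\<^sub>R x - k * x) \<le> sqrt t * norm x"
proof (cases "t = 0")
  \<comment> \<open>The rescaling by 1 / t below excludes t = 0, where the hypotheses force \<beta>
    and a to vanish.\<close>
  case True
  with \<beta> have "\<beta> = 0" by simp
  have "norm (a * x) \<le> 0 * norm x" for x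
    using contr[of x] unfolding True \<open>\<beta> = 0\<close> by simp
  then have "norm a \<le> 0" by (rule norm_le_multiplier_bound) simp
  then have "a = 0" by simp
  show thesis
    by (rule that[of 0 0]) (simp_all add: True \<open>\<beta> = 0\<close> \<open>a = 0\<close>)
next
  case False
  with \<beta> have t: "t > 0" by simp
  define \<alpha> b where "\<alpha> = 1 - \<beta> / t" and "b = - ((1 / t) *\<^sub>R a)"
  have \<alpha>: "0 \<le> \<alpha>" "\<alpha> \<le> 1" using \<beta> t by (simp_all add: \<alpha>_def)
  have contr': "norm (\<alpha> *\<^sub>R x + b * x) \<le> norm x" for x
  proof -
    have "\<alpha> *\<^sub>R x + b * x = (1 / t) *\<^sub>R (t *\<^sub>R x - \<beta> *\<^sub>R x - a * x)"
      using t by (simp add: \<alpha>_def b_def scaleR_diff_right scaleR_diff_left)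
    then have "norm (\<alpha> *\<^sub>R x + b * x) = norm (t *\<^sub>R x - \<beta> *\<^sub>R x - a * x) / t"
      using t by simp
    then show ?thesis using contr[of x] t by (simp add: divide_le_eq mult.commute)
  qed
  have "st b = b" by (simp add: b_def st_simps sa)
  from visser_limit[OF \<alpha> this contr'] obtain r k where rk: "0 \<le> r" "r \<le> 1" "r\<^sup>2 + \<alpha> = 2 * r"
    "b + (2 * r) *\<^sub>R k + k * k = 2 *\<^sub>R k" "st k = k"
    "\<And>c. c * b = b * c \<Longrightarrow> c * k = k * c"
    "\<And>x. norm (r *\<^sub>R x + k * x) \<le> norm x"
    by blast
  define s where "s = sqrt t"
  have s: "s * s = t" "s > 0" using t by (simp_all add: s_def)
  show thesis
  proof (rule that[of "s * (1 - r)" "- s *\<^sub>R k"])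
    have "(1 - r)\<^sup>2 = \<beta> / t" using rk(3) by (simp add: \<alpha>_def power2_eq_square algebra_simps)
    then show "(s * (1 - r))\<^sup>2 = \<beta>" using s t by (simp add: power_mult_distrib power2_eq_square[of s])
    have "(- s *\<^sub>R k) * (- s *\<^sub>R k) + (2 * (s * (1 - r))) *\<^sub>R (- s *\<^sub>R k)
        = (s * s) *\<^sub>R (k * k - 2 *\<^sub>R k + (2 * r) *\<^sub>R k)"
      by (simp add: algebra_simps)
    also have "k * k - 2 *\<^sub>R k + (2 * r) *\<^sub>R k = - b"
      using rk(4) by (simp add: algebra_simps eq_neg_iff_add_eq_0)
    finally show "(- s *\<^sub>R k) * (- s *\<^sub>R k) + (2 * (s * (1 - r))) *\<^sub>R (- s *\<^sub>R k) = a"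
      using s t by (simp add: b_def)
    show "c * (- s *\<^sub>R k) = (- s *\<^sub>R k) * c" if "c * a = a * c" for c
      using rk(6)[of c] that by (simp add: b_def)
    fix x
    have "sqrt t *\<^sub>R x - (s * (1 - r)) *\<^sub>R x - (- s *\<^sub>R k) * x = s *\<^sub>R (r *\<^sub>R x + k * x)"
      by (simp add: s_def[symmetric] algebra_simps)
    then show "norm (sqrt t *\<^sub>R x - (s * (1 - r)) *\<^sub>R x - (- s *\<^sub>R k) * x) \<le> sqrt t * norm x"
      using rk(7)[of x] s(2) by (simp add: s_def[symmetric])
    show "0 \<le> s * (1 - r)" using rk(2) s(2) by simp
    show "st (- s *\<^sub>R k) = - s *\<^sub>R k" by (simp add: st_simps rk(5))
  qed
qed

text \<open>If \<open>f\<^sup>2 + g\<^sup>2 = \<beta>\<close>, then \<open>f \<plusminus> i g\<close> are \<open>\<surd>\<beta>\<close> times unitaries, and \<open>f\<close> is their mean.\<close>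
lemma norm_le_of_sum_squares:
  fixes f g :: "'a \<Rightarrow> 'a"
  assumes f: "\<And>x y. st (f x) * y = st x * f y" and g: "\<And>x y. st (g x) * y = st x * g y"
    and comm: "\<And>x. f (g x) = g (f x)" and sq: "\<And>x. f (f x) + g (g x) = \<beta> *\<^sub>R x"
    and \<beta>: "0 \<le> \<beta>"
  shows "norm (f x) \<le> sqrt \<beta> * norm x"
proof -
  define u v where "u = f x + sc \<i> (g x)" and "v = f x - sc \<i> (g x)"
  have fg: "st (f x) * g x = st (g x) * f x"
    using f[of x "g x"] g[of x "f x"] comm by simp
  have sum: "st (f x) * f x + st (g x) * g x = \<beta> *\<^sub>R (st x * x)"
    by (simp add: f[of x "f x"] g[of x "g x"] sq flip: distrib_left)
  have i: "sc \<i> a * b = sc \<i> (a * b)" "a * sc \<i> b = sc \<i> (a * b)" for a b :: 'a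
    by (metis sc_mult_left, metis sc_mult_right)
  have "st u * u = st (f x) * f x + st (g x) * g x"
    unfolding u_def st_add st_sc_i by (simp add: algebra_simps i sc_i_i fg sc_add_right sc_diff)
  moreover have "st v * v = st (f x) * f x + st (g x) * g x"
    unfolding v_def st_diff st_sc_i
    by (simp add: algebra_simps i sc_i_i fg sc_add_right sc_diff)
  ultimately have "(norm u)\<^sup>2 = \<beta> * (norm x)\<^sup>2" "(norm v)\<^sup>2 = \<beta> * (norm x)\<^sup>2"
    using \<beta> unfolding norm_st_mult_self[symmetric] by (simp_all add: sum)
  then have "norm u = sqrt \<beta> * norm x" "norm v = sqrt \<beta> * norm x"
    by (metis abs_norm_cancel real_sqrt_abs real_sqrt_mult)+
  moreover have "f x = (1/2) *\<^sub>R (u + v)"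
    by (simp add: u_def v_def flip: scaleR_2)
  ultimately show ?thesis
    using norm_triangle_ineq[of u v] by simp
qed

section \<open>The cone of positive elements\<close>

definition positive :: "'a \<Rightarrow> bool" where
  "positive a \<longleftrightarrow> st a = a \<and> (\<exists>t\<ge>0. \<forall>x. norm (t *\<^sub>R x - a * x) \<le> t * norm x)"

lemma positive_selfadjoint: "positive a \<Longrightarrow> st a = a"
  by (simp add: positive_def)

lemma positive_zero [simp]: "positive 0"
  unfolding positive_def by (auto intro: exI[of _ 0])

lemma positive_add:
  assumes "positive a" "positive b"
  shows "positive (a + b)"
proof -
  obtain t where t: "t \<ge> 0" "\<And>x. norm (t *\<^sub>R x - a * x) \<le> t * norm x"
    using assms(1) positive_def by blast
  obtain u where u: "u \<ge> 0" "\<And>x. norm (u *\<^sub>R x - b * x) \<le> u * norm x"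
    using assms(2) positive_def by blast
  have "norm ((t + u) *\<^sub>R x - (a + b) * x) \<le> (t + u) * norm x" for x
    using norm_triangle_mono[OF t(2) u(2), of x x] by (simp add: algebra_simps)
  with t u assms show ?thesis
    unfolding positive_def by (auto simp: st_add intro!: exI[of _ "t + u"])
qed

lemma positive_scaleR:
  assumes "positive a" "0 \<le> r"
  shows "positive (r *\<^sub>R a)"
proof -
  obtain t where t: "t \<ge> 0" "\<And>x. norm (t *\<^sub>R x - a * x) \<le> t * norm x"
    using assms(1) positive_def by blast
  have "norm ((r * t) *\<^sub>R x - (r *\<^sub>R a) * x) \<le> (r * t) * norm x" for x
  proof -
    have "(r * t) *\<^sub>R x - (r *\<^sub>R a) * x = r *\<^sub>R (t *\<^sub>R x - a * x)"
      by (simp add: algebra_simps)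
    then show ?thesis using mult_left_mono[OF t(2)[of x] assms(2)] assms(2) by simp
  qed
  with t assms show ?thesis
    unfolding positive_def by (auto simp: st_scaleR intro!: exI[of _ "r * t"])
qed

lemma positive_sqrt:
  assumes "positive a"
  obtains s where "positive s" "s * s = a" "\<And>c. c * a = a * c \<Longrightarrow> c * s = s * c"
proof -
  obtain t where t: "t \<ge> 0" "\<And>x. norm (t *\<^sub>R x - a * x) \<le> t * norm x"
    using assms positive_def by blast
  have "norm (t *\<^sub>R x - 0 *\<^sub>R x - a * x) \<le> t * norm x" for x
    using t(2)[of x] by simp
  from unitized_sqrt[OF order_refl t(1) positive_selfadjoint[OF assms] this]
  obtain \<rho> s where s: "0 \<le> \<rho>" "\<rho>\<^sup>2 = 0" "s * s + (2 * \<rho>) *\<^sub>R s = a" "st s = s"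
    "\<And>c. c * a = a * c \<Longrightarrow> c * s = s * c"
    "\<And>x. norm (sqrt t *\<^sub>R x - \<rho> *\<^sub>R x - s * x) \<le> sqrt t * norm x"
    by blast
  from s(2) have \<rho>: "\<rho> = 0" by simp
  have "positive s"
    using t(1) s(4) s(6)[unfolded \<rho>] unfolding positive_def by (auto intro!: exI[of _ "sqrt t"])
  moreover have "s * s = a" using s(3) by (simp add: \<rho>)
  ultimately show thesis using s(5) by (rule that)
qed

text \<open>Without a unit the root of \<beta> - a need not lie in the algebra, so it is given as an
  operator x -> \<rho> x + k x that is selfadjoint and commutes with left multiplication by whatever
  commutes with a.\<close>

lemma unitized_sqrt_op:
  fixes a :: 'a
  assumes "0 \<le> \<beta>" "\<beta> \<le> t" "st a = a"
    and contr: "\<And>x. norm (t *\<^sub>R x - (\<beta> *\<^sub>R x - a * x)) \<le> t * norm x"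
  obtains g where "\<And>x y. st (g x) * y = st x * g y" "\<And>x. g (g x) = \<beta> *\<^sub>R x - a * x"
    "\<And>c x. c * a = a * c \<Longrightarrow> g (c * x) = c * g x"
proof -
  have sa: "st (- a) = - a" by (simp add: st_minus assms)
  have "norm (t *\<^sub>R x - \<beta> *\<^sub>R x - (- a) * x) \<le> t * norm x" for x
    using contr[of x] by (simp add: algebra_simps)
  from unitized_sqrt[OF assms(1,2) sa this] obtain \<rho> k where
    k: "\<rho>\<^sup>2 = \<beta>" "k * k + (2 * \<rho>) *\<^sub>R k = - a" "st k = k"
      "\<And>c. c * - a = - a * c \<Longrightarrow> c * k = k * c" by blast
  show thesis
  proof (rule that[of "\<lambda>x. \<rho> *\<^sub>R x + k * x"])
    show "st (\<rho> *\<^sub>R x + k * x) * y = st x * (\<rho> *\<^sub>R y + k * y)" for x y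
      by (simp add: st_simps k(3) algebra_simps)
    show "\<rho> *\<^sub>R (\<rho> *\<^sub>R x + k * x) + k * (\<rho> *\<^sub>R x + k * x) = \<beta> *\<^sub>R x - a * x" for x
    proof -
      have "(2 * \<rho>) *\<^sub>R k = \<rho> *\<^sub>R k + \<rho> *\<^sub>R k"
        by (simp flip: scaleR_add_left)
      then have "\<beta> *\<^sub>R x - a * x = \<rho>\<^sup>2 *\<^sub>R x + (k * k + (\<rho> *\<^sub>R k + \<rho> *\<^sub>R k)) * x"
        using k(1,2) by simp
      then show ?thesis by (simp add: algebra_simps power2_eq_square)
    qed
    show "\<rho> *\<^sub>R (c * x) + k * (c * x) = c * (\<rho> *\<^sub>R x + k * x)" if "c * a = a * c" for c x
      using k(4)[of c] that by (simp add: algebra_simps flip: mult.assoc)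
  qed
qed

text \<open>With \<beta> the norm of h^2 and g the root of \<beta> - h^2, the squares of g and h add
  up to \<beta>. Hence g has norm at most sqrt \<beta>, and its square is the operator to be
  bounded.\<close>

lemma square_multiplier_bound:
  fixes h :: 'a
  assumes "st h = h"
  shows "norm (norm (h * h) *\<^sub>R x - h * h * x) \<le> norm (h * h) * norm x"
proof -
  let ?\<beta> = "norm (h * h)"
  have sa: "st (h * h) = h * h" by (simp add: st_mult assms)
  have "norm (?\<beta> *\<^sub>R x - (?\<beta> *\<^sub>R x - h * h * x)) \<le> ?\<beta> * norm x" for x
    using norm_mult_ineq[of "h * h" x] by simp
  from unitized_sqrt_op[OF norm_ge_zero order_refl sa this] obtain g where
    g: "\<And>x y. st (g x) * y = st x * g y" "\<And>x. g (g x) = ?\<beta> *\<^sub>R x - h * h * x"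
      "\<And>c x. c * (h * h) = h * h * c \<Longrightarrow> g (c * x) = c * g x" by blast
  have bound: "norm (g x) \<le> sqrt ?\<beta> * norm x" for x
  proof (rule norm_le_of_sum_squares[where g = "\<lambda>x. h * x"])
    show "g (h * x) = h * g x" for x
      by (rule g(3)) (simp add: mult.assoc)
  qed (simp_all add: g(1,2) st_simps assms mult.assoc)
  have "norm (g (g x)) \<le> sqrt ?\<beta> * (sqrt ?\<beta> * norm x)"
    by (rule order_trans[OF bound]) (simp add: mult_left_mono bound)
  then show ?thesis by (simp add: g(2) flip: mult.assoc)
qed

lemma positive_square: "st h = h \<Longrightarrow> positive (h * h)"
  unfolding positive_def using square_multiplier_bound[of h]
  by (auto simp: st_mult intro!: exI[of _ "norm (h * h)"])

text \<open>Every positive element is a selfadjoint square, so the unspecified t in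
  \<open>positive\<close> can be taken to be \<open>norm a\<close>, which depends continuously on
  a.\<close>

lemma positive_multiplier_bound:
  assumes "positive a"
  shows "norm (norm a *\<^sub>R x - a * x) \<le> norm a * norm x"
  using positive_sqrt[OF assms] square_multiplier_bound positive_selfadjoint by metis

text \<open>Let s be the root of a and g the root of \<open>norm b\<close> - a. Their squares add up
  to \<open>norm b\<close>, which bounds s and thus a = s^2.\<close>

lemma positive_norm_mono:
  assumes "positive a" "positive (b - a)"
  shows "norm a \<le> norm b"
proof -
  obtain s where s: "positive s" "s * s = a" "\<And>c. c * a = a * c \<Longrightarrow> c * s = s * c"
    using positive_sqrt[OF assms(1)] by metis
  \<comment> \<open>\<open>norm b\<close> - a is the sum of b - a and \<open>norm b\<close> - b; the
    admissible constants of the two summands add.\<close>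
  let ?t = "norm (b - a) + norm b"
  have "norm (?t *\<^sub>R x - (norm b *\<^sub>R x - a * x)) \<le> ?t * norm x" for x
  proof -
    have "?t *\<^sub>R x - (norm b *\<^sub>R x - a * x) = (norm (b - a) *\<^sub>R x - (b - a) * x) + b * x"
      by (simp add: algebra_simps)
    also have "norm \<dots> \<le> norm (b - a) * norm x + norm b * norm x"
      by (intro norm_triangle_mono positive_multiplier_bound assms norm_mult_ineq)
    finally show ?thesis by (simp add: algebra_simps)
  qed
  from unitized_sqrt_op[OF norm_ge_zero _ positive_selfadjoint[OF assms(1)] this] obtain g where
    g: "\<And>x y. st (g x) * y = st x * g y" "\<And>x. g (g x) = norm b *\<^sub>R x - a * x"
      "\<And>c x. c * a = a * c \<Longrightarrow> g (c * x) = c * g x" by auto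
  have "norm (s * x) \<le> sqrt (norm b) * norm x" for x
  proof (rule norm_le_of_sum_squares[where f = "\<lambda>x. s * x" and g = g])
    show "s * g x = g (s * x)" for x
      by (rule g(3)[symmetric]) (simp add: mult.assoc flip: s(2))
  qed (simp_all add: g(1,2) st_simps positive_selfadjoint[OF s(1)] mult.assoc flip: s(2))
  then have "norm s \<le> sqrt (norm b)"
    by (rule norm_le_multiplier_bound) simp
  then have "(norm s)\<^sup>2 \<le> (sqrt (norm b))\<^sup>2"
    by (rule power_mono) simp
  then show ?thesis
    using norm_square_selfadjoint[OF positive_selfadjoint[OF s(1)]] by (simp add: s(2))
qed

lemma positive_antisym: "positive a \<Longrightarrow> positive (- a) \<Longrightarrow> a = 0"
  using positive_norm_mono[of a 0] by simp

text \<open>The bound with t = \<open>norm (f n)\<close> passes to the limit, as both of its sides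
  are continuous.\<close>

lemma positive_limit:
  assumes "\<And>e. 0 < e \<Longrightarrow> positive (a + e *\<^sub>R b)"
  shows "positive a"
proof -
  define f where "f n = a + inverse (real (Suc n)) *\<^sub>R b" for n
  have f: "positive (f n)" for n
    unfolding f_def by (intro assms) simp
  have "f \<longlonglongrightarrow> a + 0 *\<^sub>R b"
    unfolding f_def by (intro tendsto_intros LIMSEQ_inverse_real_of_nat)
  then have lim: "f \<longlonglongrightarrow> a" by simp
  have "f \<longlonglongrightarrow> st a"
    using tendsto_st[OF lim] by (simp add: positive_selfadjoint[OF f])
  then have "st a = a" using lim by (rule LIMSEQ_unique)
  moreover have "norm (norm a *\<^sub>R x - a * x) \<le> norm a * norm x" for x
  proof (rule LIMSEQ_le)
    show "(\<lambda>n. norm (norm (f n) *\<^sub>R x - f n * x)) \<longlonglongrightarrow> norm (norm a *\<^sub>R x - a * x)"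
      "(\<lambda>n. norm (f n) * norm x) \<longlonglongrightarrow> norm a * norm x"
      by (intro tendsto_intros lim)+
  qed (use positive_multiplier_bound[OF f] in blast)
  ultimately show ?thesis
    unfolding positive_def by (auto intro!: exI[of _ "norm a"])
qed

text \<open>The square roots of a and b commute as well, so their product is selfadjoint with square
  a b.\<close>

lemma positive_mult_commute:
  assumes "positive a" "positive b" "a * b = b * a"
  shows "positive (a * b)"
proof -
  obtain s where s: "positive s" "s * s = a" "\<And>c. c * a = a * c \<Longrightarrow> c * s = s * c"
    using positive_sqrt[OF assms(1)] by metis
  obtain u where u: "positive u" "u * u = b" "\<And>c. c * b = b * c \<Longrightarrow> c * u = u * c"
    using positive_sqrt[OF assms(2)] by metis
  have su: "s * u = u * s" using s(3)[of b] u(3)[of s] assms(3) by simp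
  then have "(s * u) * (s * u) = a * b"
    by (simp flip: s(2) u(2)) (metis mult.assoc)
  moreover have "st (s * u) = s * u"
    using su by (simp add: st_mult positive_selfadjoint s u)
  ultimately show ?thesis using positive_square by metis
qed

section \<open>Positivity of \<open>st c * c\<close>\<close>

lemma eq_0_if_square_square_eq_0:
  fixes n :: 'a
  assumes "st n = n" "n * n * (n * n) = 0"
  shows "n = 0"
  using assms norm_square_selfadjoint[of n] norm_square_selfadjoint[of "n * n"]
  by (simp add: st_mult)

text \<open>With \<open>q = - d\<^sup>* d\<close>, the elements \<open>(1 + q / T)\<^sup>n q = - d\<^sup>* (1 - d d\<^sup>* / T)\<^sup>n d\<close> stay bounded
  since \<open>1 - d d\<^sup>* / T\<close> is a contraction, yet dominate \<open>(n / T) q\<^sup>2\<close>.\<close>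
lemma eq_0_if_opposite_signs:
  assumes pos: "positive (d * st d)" and neg: "positive (- (st d * d))"
  shows "d = 0"
proof -
  define q where "q = - (st d * d)"
  \<comment> \<open>The added 1 makes T positive while keeping 1 - d \<open>st d\<close> / T a
    contraction.\<close>
  define T where "T = norm (d * st d) + 1"
  have T: "T > 0" by (simp add: T_def add_nonneg_pos)
  have contr: "norm (x - (1/T) *\<^sub>R (d * st d * x)) \<le> norm x" for x
  proof -
    have "norm (T *\<^sub>R x - d * st d * x)
        = norm ((norm (d * st d) *\<^sub>R x - d * st d * x) + x)"
      by (simp add: T_def algebra_simps)
    also have "\<dots> \<le> norm (d * st d) * norm x + norm x"
      by (intro norm_triangle_mono positive_multiplier_bound pos order_refl)
    also have "\<dots> = T * norm x" by (simp add: T_def algebra_simps)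
    finally have "norm (T *\<^sub>R x - d * st d * x) / T \<le> norm x"
      using T by (simp add: divide_le_eq mult.commute)
    moreover have "x - (1/T) *\<^sub>R (d * st d * x) = (1/T) *\<^sub>R (T *\<^sub>R x - d * st d * x)"
      using T by (simp add: scaleR_diff_right)
    ultimately show ?thesis using T by simp
  qed
  define B where "B n = ((\<lambda>z. z + (1/T) *\<^sub>R (q * z)) ^^ n) q" for n
  define G where "G n = ((\<lambda>z. z - (1/T) *\<^sub>R (d * st d * z)) ^^ n) d" for n
  have B: "B 0 = q" "B (Suc n) = B n + (1/T) *\<^sub>R (q * B n)" for n
    by (simp_all add: B_def)
  have G: "G 0 = d" "G (Suc n) = G n - (1/T) *\<^sub>R (d * st d * G n)" for n
    by (simp_all add: G_def)
  have "B n = - (st d * G n)" for n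
  proof (induction n)
    case (Suc n)
    then show ?case by (simp add: B G q_def algebra_simps)
  qed (simp add: B G q_def)
  moreover have "norm (G n) \<le> norm d" for n
    by (induction n) (use contr order_trans in \<open>auto simp: G\<close>)
  ultimately have bound: "norm (B n) \<le> norm d * norm d" for n
    using norm_mult_ineq[of "st d" "G n"]
    by (metis mult_left_mono norm_ge_zero norm_minus_cancel norm_st order_trans)
  have qq: "positive (q * q)"
    by (intro positive_square positive_selfadjoint) (use neg in \<open>simp add: q_def\<close>)
  \<comment> \<open>Passing from n to n + 1 adds q^2 / T plus q (B n - q) / T. The latter is
    positive as a product of commuting positive elements, so commutation is carried through the
    induction.\<close>
  have "q * B n = B n * q \<and> positive (B n - q - (real n / T) *\<^sub>R (q * q))" for n
  proof (induction n)
    case (Suc n)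
    then have comm: "q * B n = B n * q" by simp
    have "positive (B n - q)"
      using positive_add[OF conjunct2[OF Suc] positive_scaleR[OF qq, of "real n / T"]] T by simp
    then have "positive (q * (B n - q))"
      using neg comm by (intro positive_mult_commute) (simp_all add: q_def[symmetric] algebra_simps)
    then have "positive (B n - q - (real n / T) *\<^sub>R (q * q) + (1/T) *\<^sub>R (q * (B n - q)))"
      using Suc T by (intro positive_add positive_scaleR) auto
    moreover have "B (Suc n) - q - (real (Suc n) / T) *\<^sub>R (q * q)
        = B n - q - (real n / T) *\<^sub>R (q * q) + (1/T) *\<^sub>R (q * (B n - q))"
      by (simp add: B algebra_simps add_divide_distrib)
    moreover have "q * (B n * q) = B n * (q * q)" by (metis comm mult.assoc)
    then have "q * B (Suc n) = B (Suc n) * q"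
      by (simp add: B distrib_left distrib_right mult.assoc comm)
    ultimately show ?case by (simp only:)
  qed (simp add: B)
  then have "positive (B n - (real n / T) *\<^sub>R (q * q))" for n
    using positive_add[OF conjunct2, of _ "B n - q - (real n / T) *\<^sub>R (q * q)" q] neg
    by (simp add: q_def[symmetric] algebra_simps)
  then have "norm ((real n / T) *\<^sub>R (q * q)) \<le> norm d * norm d" for n
    using positive_norm_mono[OF positive_scaleR[OF qq]] bound[of n] T
    by (metis divide_nonneg_pos of_nat_0_le_iff order_trans)
  then have "real n * norm (q * q) \<le> norm d * norm d * T" for n
    using T by (simp add: field_simps)
  then have "norm (q * q) = 0"
    using reals_Archimedean3[of "norm (q * q)"] by (metis less_le not_less norm_ge_zero)
  then have "q = 0"
    using norm_square_selfadjoint[of q] positive_selfadjoint[OF neg] by (simp add: q_def)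
  then show ?thesis by (simp add: q_def st_mult_self_eq_0)
qed

text \<open>Here \<open>n = \<bar>h\<bar> - h\<close> is twice the negative part of \<open>h\<close>.\<close>
lemma selfadjoint_negative_part:
  assumes "st h = h"
  obtains n where "st n = n" "positive (- (n * (h * n)))" "n * (h * n) = 0 \<Longrightarrow> positive h"
proof -
  obtain k where k: "positive k" "k * k = h * h" "\<And>c. c * (h * h) = h * h * c \<Longrightarrow> c * k = k * c"
    using positive_sqrt[OF positive_square[OF assms]] by metis
  have hk: "h * k = k * h" using k(3)[of h] by (simp add: mult.assoc)
  define n where "n = k - h"
  have st_n: "st n = n" by (simp add: n_def st_diff positive_selfadjoint k assms)
  have kn: "k * n = n * k" by (simp add: n_def algebra_simps hk)
  have hn: "h * n = - (k * n)" by (simp add: n_def algebra_simps hk k)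
  have nn: "n * n = 2 *\<^sub>R (k * n)" by (simp add: n_def algebra_simps hk k scaleR_2)
  \<comment> \<open>From n^2 = 2 k n and h n = - k n it follows that n^4 vanishes as soon as n h n
    does.\<close>
  have "n * n * (n * n) = n * (n * n) * n" by (simp add: mult.assoc)
  also have "\<dots> = 2 *\<^sub>R (n * (k * n) * n)" by (simp add: nn)
  finally have nnnn: "n * n * (n * n) = 2 *\<^sub>R (n * (k * n) * n)" .
  have knn: "n * (k * n) = k * (n * n)" by (metis kn mult.assoc)
  then have "k * (n * n) = n * n * k" by (simp add: kn mult.assoc)
  then have "positive (k * (n * n))"
    by (rule positive_mult_commute[OF k(1) positive_square[OF st_n]])
  with knn have "positive (n * (k * n))" by simp
  then have 1: "positive (- (n * (h * n)))" by (simp add: hn)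
  have "positive h" if "n * (h * n) = 0"
  proof -
    have "n * (k * n) * n = 0" using that by (simp add: hn)
    then have "n * n * (n * n) = 0" by (simp add: nnnn)
    then have "n = 0" by (rule eq_0_if_square_square_eq_0[OF st_n])
    then show ?thesis using k(1) by (simp add: n_def)
  qed
  with st_n 1 show thesis by (rule that)
qed

text \<open>For h = \<open>st c * c\<close> with negative part n / 2, put d = c n. Then
  \<open>st d * d\<close> = n h n is negative, while d \<open>st d\<close> turns out positive. Such
  opposite signs force d = 0, so n h n = 0 and h is positive.\<close>

theorem positive_st_mult_self: "positive (st c * c)"
proof -
  define h where "h = st c * c"
  have "st h = h" by (simp add: h_def st_mult)
  from selfadjoint_negative_part[OF this] obtain n where n: "st n = n"
    "positive (- (n * (h * n)))" "n * (h * n) = 0 \<Longrightarrow> positive h" by blast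
  define d where "d = c * n"
  have dd: "st d * d = n * (h * n)" by (simp add: d_def h_def st_mult n mult.assoc)
  \<comment> \<open>Up to factors 2 and -2 these are the real and imaginary parts of d. The sum of
    their squares gives d \<open>st d\<close> + \<open>st d\<close> d as a positive element.\<close>
  define p q where "p = d + st d" and "q = sc \<i> (d - st d)"
  have "p * p + q * q = 2 *\<^sub>R (d * st d + st d * d)"
  proof -
    have "q * q = - ((d - st d) * (d - st d))"
      unfolding q_def by (metis sc_mult_left sc_mult_right sc_i_i)
    then show ?thesis by (simp add: p_def algebra_simps scaleR_2)
  qed
  moreover have "st p = p" "st q = q"
    by (simp_all add: p_def q_def st_sc_i st_simps sc_diff add.commute)
  ultimately have "positive ((1/2) *\<^sub>R (2 *\<^sub>R (d * st d + st d * d)) + - (st d * d))"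
    using n(2) dd positive_square
    by (metis positive_add positive_scaleR divide_nonneg_nonneg zero_le_one zero_le_numeral)
  then have "positive (d * st d)" by simp
  then have "d = 0" using n(2) by (intro eq_0_if_opposite_signs) (simp_all add: dd)
  then show ?thesis using n(3) dd by (simp add: h_def)
qed

lemma cpos_iff_positive: "cpos st a \<longleftrightarrow> positive a"
  unfolding cpos_def using positive_st_mult_self positive_sqrt positive_selfadjoint by metis

lemma positive_conj: "positive a \<Longrightarrow> positive (st x * (a * x))"
  using positive_sqrt[of a] positive_st_mult_self positive_selfadjoint by (metis mult.assoc st_mult)

text \<open>With g the root of \<open>norm a\<close> - a, the element in question is
  \<open>st (g x) * g x\<close>.\<close>

lemma selfadjoint_conj_le_norm:
  assumes "st a = a"
  shows "positive (norm a *\<^sub>R (st x * x) - st x * (a * x))"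
proof -
  have "norm (norm a *\<^sub>R x - (norm a *\<^sub>R x - a * x)) \<le> norm a * norm x" for x
    using norm_mult_ineq[of a x] by simp
  from unitized_sqrt_op[OF norm_ge_zero order_refl assms this] obtain g where
    g: "\<And>x y. st (g x) * y = st x * g y" "\<And>x. g (g x) = norm a *\<^sub>R x - a * x"
      "\<And>c x. c * a = a * c \<Longrightarrow> g (c * x) = c * g x" by blast
  have "st (g x) * g x = norm a *\<^sub>R (st x * x) - st x * (a * x)"
    by (simp add: g algebra_simps)
  then show ?thesis by (metis positive_st_mult_self)
qed

text \<open>Compare any positive root c with the root k that commutes with the commutant of b^2. For
  z = c - k, (c + k) z = 0, so the positive elements c z^2 and k z^2 are opposite and vanish. Their
  difference is z^3, whence z = 0.\<close>

lemma positive_sqrt_unique: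
  assumes "positive a" "positive b" "a * a = b * b"
  shows "a = b"
proof -
  obtain k where k: "positive k" "k * k = b * b" "\<And>c. c * (b * b) = b * b * c \<Longrightarrow> c * k = k * c"
    using positive_sqrt[OF positive_square[OF positive_selfadjoint[OF assms(2)]]] by metis
  have "c = k" if c: "positive c" "c * c = b * b" for c
  proof -
    have ck: "c * k = k * c" by (intro k(3)) (simp add: mult.assoc flip: c(2))
    define z where "z = c - k"
    have st_z: "st z = z" by (simp add: z_def st_diff positive_selfadjoint c k)
    have comm: "c * (z * z) = z * z * c" "k * (z * z) = z * z * k"
      by (simp_all add: z_def left_diff_distrib right_diff_distrib) (metis ck mult.assoc)+
    have pos: "positive (c * (z * z))" "positive (k * (z * z))"
      by (intro positive_mult_commute positive_square st_z c k comm)+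
    have "(c + k) * z = 0" by (simp add: z_def algebra_simps ck c k)
    then have "(c + k) * z * z = 0" by simp
    then have "k * (z * z) = - (c * (z * z))"
      by (simp add: distrib_right mult.assoc eq_neg_iff_add_eq_0 add.commute)
    with pos have 0: "c * (z * z) = 0" "k * (z * z) = 0"
      using positive_antisym[OF pos(1)] by simp_all
    have "z * (z * z) = c * (z * z) - k * (z * z)"
      unfolding z_def by (rule left_diff_distrib)
    then have "z * (z * z) = 0" by (simp add: 0)
    then have "z * z * (z * z) = 0" by (simp add: mult.assoc)
    then have "z = 0" by (rule eq_0_if_square_square_eq_0[OF st_z])
    then show ?thesis by (simp add: z_def)
  qed
  from this[OF assms(1,3)] this[OF assms(2) refl] show ?thesis by simp
qed

section \<open>Monotonicity of the square root\<close>

text \<open>The hypothesis on \<open>\<kappa>\<close> says \<open>X \<ge> -\<kappa>\<close> for \<open>X = (t + \<delta>) - s\<close>. With \<open>m = (t + \<delta>) + s\<close> and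
  \<open>G = 1 - \<epsilon> m\<close> one has \<open>X = G X G + 2 \<epsilon> ((t + \<delta>)\<^sup>2 - s\<^sup>2) - \<epsilon>\<^sup>2 m X m\<close>, and since
  \<open>m \<ge> \<delta>\<close> this improves the lower bound on \<open>X\<close>.\<close>
lemma lyapunov_step:
  fixes s t :: 'a
  assumes s: "positive s" and t: "positive t" and le: "positive (t * t - s * s)"
    and nonneg: "0 \<le> \<delta>" "0 \<le> \<kappa>" "0 \<le> \<epsilon>"
    and C: "C = norm (t - s) + \<delta>"
    and K: "K = norm ((t + s) * (t + s) + \<delta> *\<^sub>R (t + s) + \<delta> *\<^sub>R (t + s)) + \<delta>\<^sup>2"
    and \<epsilon>: "\<epsilon> * K \<le> \<delta>"
    and X: "\<And>y. positive (st y * ((t - s) * y) + (\<delta> + \<kappa>) *\<^sub>R (st y * y))"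
  shows "positive (st y * ((t - s) * y) + (\<delta> + (\<kappa> * (1 - \<epsilon> * \<delta>) + \<epsilon>\<^sup>2 * C * K)) *\<^sub>R (st y * y))"
proof -
  \<comment> \<open>This m lacks the summand \<delta> of the m described above; z and w are the full
    m and G applied to y.\<close>
  define h m where "h = t - s" and "m = t + s"
  define z where "z = m * y + \<delta> *\<^sub>R y"
  define w where "w = y - \<epsilon> *\<^sub>R z"
  have sa: "st s = s" "st t = t" using s t positive_selfadjoint by auto
  have st_h: "st h = h" and st_m: "st m = m" by (simp_all add: h_def m_def st_simps sa)
  have m: "positive m" unfolding m_def by (intro positive_add s t)
  define q where "q = m * m + \<delta> *\<^sub>R m + \<delta> *\<^sub>R m"
  have st_q: "st q = q" by (simp add: q_def st_simps st_m)
  have zz: "st z * z = st y * (q * y) + \<delta>\<^sup>2 *\<^sub>R (st y * y)"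
    by (simp add: z_def q_def st_simps st_m algebra_simps power2_eq_square)
  have zy: "st z * y = st y * z" by (simp add: z_def st_simps st_m algebra_simps)
  \<comment> \<open>With X and the full m as above, a to e express X \<ge> -\<kappa> at w, X \<le> C
    at z, and at y: m^2 \<le> K, m \<ge> \<delta>, (t + \<delta>)^2 \<ge> s^2. The claim is a
    nonnegative combination of these and \<open>st y * y\<close>.\<close>
  define a where "a = st w * (h * w) + (\<delta> + \<kappa>) *\<^sub>R (st w * w)"
  define b where "b = C *\<^sub>R (st z * z) - st z * (h * z) - \<delta> *\<^sub>R (st z * z)"
  define c where "c = K *\<^sub>R (st y * y) - st z * z"
  define d where "d = st y * z - \<delta> *\<^sub>R (st y * y)"
  define e where "e = st y * ((t * t - s * s) * y) + \<delta> *\<^sub>R (st y * (t * y)) + \<delta> *\<^sub>R (st y * (t * y))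
    + \<delta>\<^sup>2 *\<^sub>R (st y * y)"
  have a: "positive a" unfolding a_def h_def by (rule X)
  have "b = norm h *\<^sub>R (st z * z) - st z * (h * z)"
    by (simp add: b_def C h_def algebra_simps)
  then have b: "positive b" using selfadjoint_conj_le_norm[OF st_h] by simp
  have "c = norm q *\<^sub>R (st y * y) - st y * (q * y)"
    by (simp add: c_def K zz q_def m_def algebra_simps)
  then have c: "positive c" using selfadjoint_conj_le_norm[OF st_q] by simp
  have "d = st y * (m * y)" by (simp add: d_def z_def algebra_simps)
  then have d: "positive d" using positive_conj[OF m] by simp
  have e: "positive e"
    unfolding e_def using nonneg
    by (intro positive_add positive_scaleR positive_conj positive_st_mult_self t le) auto
  have whw: "st w * (h * w) = st y * (h * y) - \<epsilon> *\<^sub>R (st z * (h * y) + st y * (h * z))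
      + \<epsilon>\<^sup>2 *\<^sub>R (st z * (h * z))"
    by (simp add: w_def st_simps algebra_simps power2_eq_square)
  have ww: "st w * w = st y * y - \<epsilon> *\<^sub>R (st y * z + st y * z) + \<epsilon>\<^sup>2 *\<^sub>R (st z * z)"
    by (simp add: w_def st_simps algebra_simps power2_eq_square zy)
  have zhy: "st z * (h * y) + st y * (h * z) = e + e - \<delta> *\<^sub>R (st y * z + st y * z)"
    by (simp add: e_def z_def h_def m_def st_simps sa algebra_simps power2_eq_square)
  have "st y * (h * y) + (\<delta> + (\<kappa> * (1 - \<epsilon> * \<delta>) + \<epsilon>\<^sup>2 * C * K)) *\<^sub>R (st y * y)
      = a + \<epsilon> *\<^sub>R (e + e) + \<epsilon>\<^sup>2 *\<^sub>R b + (\<epsilon> * \<kappa>) *\<^sub>R (d + d) + (\<epsilon>\<^sup>2 * (C + \<kappa>)) *\<^sub>R c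
        + (\<kappa> * \<epsilon> * (\<delta> - \<epsilon> * K)) *\<^sub>R (st y * y)"
    unfolding a_def whw ww zhy b_def c_def d_def
    by (simp add: algebra_simps power2_eq_square)
  moreover have "positive \<dots>"
    using nonneg \<epsilon> by (intro positive_add positive_scaleR a b c d e positive_st_mult_self)
      (simp_all add: C)
  ultimately show ?thesis by (simp add: h_def)
qed

text \<open>Starting from \<kappa> = \<open>norm (t - s)\<close>, iterating
  \<open>lyapunov_step\<close> brings \<kappa> below \<delta>, so t - s \<ge> -2 \<delta> as a
  quadratic form. Then \<delta> tends to 0.\<close>

theorem positive_sqrt_mono:
  assumes s: "positive s" and t: "positive t" and le: "positive (t * t - s * s)"
  shows "positive (t - s)"
proof -
  have st_h: "st (t - s) = t - s" by (simp add: st_diff positive_selfadjoint s t)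
  have approx: "positive (st y * ((t - s) * y) + (\<delta> + \<delta>) *\<^sub>R (st y * y))" if \<delta>: "0 < \<delta>" for \<delta> y
  proof -
    define C K where "C = norm (t - s) + \<delta>"
      and "K = norm ((t + s) * (t + s) + \<delta> *\<^sub>R (t + s) + \<delta> *\<^sub>R (t + s)) + \<delta>\<^sup>2"
    have CK: "0 \<le> C" "0 \<le> K" using \<delta> by (simp_all add: C_def K_def)
    define S where "S = {\<kappa>. \<forall>y. positive (st y * ((t - s) * y) + (\<delta> + \<kappa>) *\<^sub>R (st y * y))}"
    \<comment> \<open>The three terms ensure \<epsilon> K \<le> \<delta>, \<epsilon> \<delta> < 1
      and \<epsilon> C K < \<delta>^2. The last puts the fixed point \<epsilon> C K / \<delta> of
      the iteration below \<delta>.\<close>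
    define \<epsilon> where "\<epsilon> = min (\<delta> / (K + 1)) (min (1 / (2 * \<delta>)) (\<delta>\<^sup>2 / (2 * (C * K + 1))))"
    have "0 < \<epsilon>" using \<delta> CK by (simp add: \<epsilon>_def add_nonneg_pos)
    have "\<epsilon> * (K + 1) \<le> \<delta>"
      using CK by (simp add: \<epsilon>_def add_nonneg_pos flip: pos_le_divide_eq)
    then have \<epsilon>K: "\<epsilon> * K \<le> \<delta>" using \<open>0 < \<epsilon>\<close> by (simp add: algebra_simps)
    have "\<epsilon> * (2 * \<delta>) \<le> 1"
      using \<delta> by (simp add: \<epsilon>_def min_def flip: pos_le_divide_eq)
    then have \<epsilon>\<delta>: "\<epsilon> * \<delta> < 1" by simp
    have "\<epsilon> * (2 * (C * K + 1)) \<le> \<delta>\<^sup>2"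
      using CK by (simp add: \<epsilon>_def add_nonneg_pos flip: pos_le_divide_eq)
    moreover have "\<epsilon> * (2 * (C * K + 1)) = 2 * \<epsilon> + 2 * (\<epsilon> * C * K)"
      by (simp add: algebra_simps)
    moreover have "0 \<le> \<epsilon> * C * K" using \<open>0 < \<epsilon>\<close> CK by simp
    ultimately have "\<epsilon> * C * K < \<delta>\<^sup>2" using \<open>0 < \<epsilon>\<close> by linarith
    then have c: "\<epsilon>\<^sup>2 * C * K < \<delta> * (1 - (1 - \<epsilon> * \<delta>))"
      using \<open>0 < \<epsilon>\<close> by (simp add: power2_eq_square mult.assoc mult.left_commute[of \<delta> \<epsilon>])
    have "norm (t - s) \<in> S"
    proof -
      have "positive (norm (t - s) *\<^sub>R (st y * y) + st y * ((t - s) * y) + \<delta> *\<^sub>R (st y * y))" for y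
      proof (rule positive_add)
        show "positive (norm (t - s) *\<^sub>R (st y * y) + st y * ((t - s) * y))"
          using selfadjoint_conj_le_norm[of "- (t - s)" y]
          by (simp only: st_minus st_h) (simp add: norm_minus_commute algebra_simps)
        show "positive (\<delta> *\<^sub>R (st y * y))"
          using \<delta> by (intro positive_scaleR positive_st_mult_self) simp
      qed
      then show ?thesis by (simp add: S_def algebra_simps)
    qed
    moreover have "\<kappa> * (1 - \<epsilon> * \<delta>) + \<epsilon>\<^sup>2 * C * K \<in> S" if "\<kappa> \<in> S" "0 \<le> \<kappa>" for \<kappa>
      using lyapunov_step[OF s t le _ that(2) _ C_def K_def \<epsilon>K] \<delta> \<open>0 < \<epsilon>\<close> that(1)
      by (simp add: S_def)
    ultimately obtain \<kappa> where \<kappa>: "\<kappa> \<in> S" "0 \<le> \<kappa>" "\<kappa> < \<delta>"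
      using affine_contraction_below[of "norm (t - s)" S "1 - \<epsilon> * \<delta>" "\<epsilon>\<^sup>2 * C * K" \<delta>] \<epsilon>\<delta> c CK \<delta> \<open>0 < \<epsilon>\<close>
      by auto
    have "positive (st y * ((t - s) * y) + (\<delta> + \<kappa>) *\<^sub>R (st y * y) + (\<delta> - \<kappa>) *\<^sub>R (st y * y))"
    proof (rule positive_add)
      show "positive (st y * ((t - s) * y) + (\<delta> + \<kappa>) *\<^sub>R (st y * y))"
        using \<kappa>(1) by (simp add: S_def)
      show "positive ((\<delta> - \<kappa>) *\<^sub>R (st y * y))"
        using \<kappa>(3) by (intro positive_scaleR positive_st_mult_self) simp
    qed
    moreover have "(\<delta> + \<kappa>) *\<^sub>R (st y * y) + (\<delta> - \<kappa>) *\<^sub>R (st y * y) = (\<delta> + \<delta>) *\<^sub>R (st y * y)"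
      by (simp flip: scaleR_add_left)
    ultimately show ?thesis by (simp only: add.assoc)
  qed
  \<comment> \<open>In place of a unit, y is finally taken to be n, twice the negative part of t -
    s: n (t - s) n then has both signs, hence vanishes.\<close>
  have "positive (st y * ((t - s) * y))" for y
  proof (rule positive_limit)
    show "positive (st y * ((t - s) * y) + e *\<^sub>R (st y * y))" if "0 < e" for e
      using approx[of "e/2" y] that by simp
  qed
  moreover obtain n where n: "st n = n" "positive (- (n * ((t - s) * n)))"
    "n * ((t - s) * n) = 0 \<Longrightarrow> positive (t - s)"
    using selfadjoint_negative_part[OF st_h] by blast
  ultimately show ?thesis
    using positive_antisym by metis
qed

end

section \<open>Orthogonality in Hilbert modules\<close>

locale hilbert_cstar_module =
  fixes sc :: "complex \<Rightarrow> 'a::{real_normed_algebra,banach} \<Rightarrow> 'a"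
    and st :: "'a \<Rightarrow> 'a"
    and scX :: "complex \<Rightarrow> 'x::ab_group_add \<Rightarrow> 'x"
    and act :: "'x \<Rightarrow> 'a \<Rightarrow> 'x"
    and ip :: "'x \<Rightarrow> 'x \<Rightarrow> 'a"
  assumes hilbert_module: "hilbert_module sc st scX act ip"
begin

sublocale cstar sc st
  by unfold_locales (use hilbert_module in \<open>simp add: hilbert_module_def\<close>)

lemma ip_add_right: "ip x (y + z) = ip x y + ip x z"
  and ip_act_right: "ip x (act y a) = ip x y * a"
  and st_ip: "st (ip x y) = ip y x"
  and ip_self_eq_0: "ip x x = 0 \<Longrightarrow> x = 0"
  using hilbert_module unfolding hilbert_module_def by metis+

lemma positive_ip_self: "positive (ip x x)"
  using hilbert_module unfolding hilbert_module_def cpos_iff_positive by blast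

lemma ip_add_left: "ip (x + y) z = ip x z + ip y z"
  by (metis ip_add_right st_add st_ip)

lemma ip_act_left: "ip (act x a) y = st a * ip x y"
  by (metis ip_act_right st_ip st_mult)

lemma ip_zero_right: "ip x 0 = 0"
  using ip_add_right[of x 0 0] by simp

lemma ip_commute_eq_0: "ip y x = 0 \<longleftrightarrow> ip x y = 0"
  by (metis st_ip st_zero)

lemma ip_translate:
  "ip (act x a + y) (act x a + y)
     = ip (act x a) (act x a) + (st a * ip x y + ip y x * a) + ip y y"
  by (simp add: ip_add_left ip_add_right ip_act_left ip_act_right algebra_simps)

text \<open>Existence and uniqueness of the positive root make the definite description in
  \<open>habs_def\<close> meaningful.\<close>

lemma habs: "positive (habs st ip z)" "habs st ip z * habs st ip z = ip z z"
proof -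
  have "\<exists>!b. positive b \<and> b * b = ip z z"
    using positive_sqrt[OF positive_ip_self[of z]] positive_sqrt_unique by metis
  then have "positive (habs st ip z) \<and> habs st ip z * habs st ip z = ip z z"
    unfolding habs_def cpos_iff_positive by (rule theI')
  then show "positive (habs st ip z)" "habs st ip z * habs st ip z = ip z z" by auto
qed

lemma norm_habs: "norm (habs st ip z) = hnorm ip z"
  using norm_square_selfadjoint[OF positive_selfadjoint[OF habs(1)], of z]
  by (simp add: habs(2) hnorm_def)

lemma cle_iff_positive: "cle st a b \<longleftrightarrow> positive (b - a)"
  by (simp add: cle_def cpos_iff_positive)

lemma orthogonal_if_hnorm_le:
  assumes le: "\<And>a. hnorm ip (act x a) \<le> hnorm ip (act x a + y)"
  shows "ip x y = 0"
proof -
  define p where "p = ip x y"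
  define M where "M = norm (ip x x) + 1"
  define P T Q where "P = st p * p" and "T = st p * (ip x x * p)" and "Q = ip y y"
  have yx: "ip y x = st p" by (simp add: p_def st_ip)
  have "M > 0" by (simp add: M_def add_nonneg_pos)
  have "T = ip (act x p) (act x p)"
    by (simp add: T_def ip_act_left ip_act_right mult.assoc)
  then have T: "positive T" using positive_ip_self by simp
  have "positive (norm (ip x x) *\<^sub>R P - T + P)"
    unfolding P_def T_def
    by (intro positive_add selfadjoint_conj_le_norm positive_st_mult_self st_ip)
  then have MP: "positive (M *\<^sub>R P - T)" by (simp add: M_def algebra_simps)
  \<comment> \<open>The condition on r makes r^2 - 2 r / M nonnegative, so the triangle inequality
    keeps this coefficient and the r^2 terms cancel.\<close>
  have bound: "r * norm T \<le> M * norm Q / 2" if r: "2 / M \<le> r" for r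
  proof -
    have "r > 0" using r \<open>M > 0\<close> by (meson divide_pos_pos less_le_trans zero_less_numeral)
    have "r\<^sup>2 - 2 * r / M \<ge> 0"
      using r \<open>r > 0\<close> mult_left_mono[OF r, of r] by (simp add: power2_eq_square mult.commute)
    let ?a = "(- r) *\<^sub>R p"
    let ?z = "act x ?a + y"
    have z: "ip ?z ?z = r\<^sup>2 *\<^sub>R T - r *\<^sub>R (P + P) + Q"
      unfolding ip_translate yx p_def[symmetric]
      by (simp add: ip_act_left ip_act_right st_simps P_def T_def Q_def power2_eq_square
          scaleR_add_right mult.assoc)
    have xa: "ip (act x ?a) (act x ?a) = r\<^sup>2 *\<^sub>R T"
      by (simp add: ip_act_left ip_act_right st_simps T_def power2_eq_square mult.assoc)
    have "r\<^sup>2 * norm T = norm (ip (act x ?a) (act x ?a))"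
      unfolding xa by simp
    also have "\<dots> \<le> norm (ip ?z ?z)"
      using le[of ?a] by (simp add: hnorm_def)
    also have "\<dots> \<le> norm ((r\<^sup>2 - 2 * r / M) *\<^sub>R T + Q)"
    proof (rule positive_norm_mono[OF positive_ip_self])
      have "(r\<^sup>2 - 2 * r / M) *\<^sub>R T + Q - ip ?z ?z = (2 * r / M) *\<^sub>R (M *\<^sub>R P - T)"
        unfolding z using \<open>M > 0\<close>
        by (simp add: scaleR_diff_left scaleR_diff_right mult.commute flip: scaleR_2)
      then show "positive ((r\<^sup>2 - 2 * r / M) *\<^sub>R T + Q - ip ?z ?z)"
        using positive_scaleR[OF MP, of "2 * r / M"] \<open>M > 0\<close> \<open>r > 0\<close> by simp
    qed
    also have "\<dots> \<le> (r\<^sup>2 - 2 * r / M) * norm T + norm Q"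
      using norm_triangle_ineq[of "(r\<^sup>2 - 2 * r / M) *\<^sub>R T" Q] \<open>r\<^sup>2 - 2 * r / M \<ge> 0\<close> by simp
    finally show ?thesis using \<open>M > 0\<close> by (simp add: field_simps)
  qed
  have "norm T = 0"
  proof (rule ccontr)
    assume "norm T \<noteq> 0"
    then have nT: "norm T > 0" by simp
    obtain n :: nat where "real n * norm T > M * norm Q / 2"
      using reals_Archimedean3[OF nT] by blast
    moreover have "real n * norm T \<le> max (real n) (2 / M) * norm T"
      by (rule mult_right_mono) auto
    ultimately show False using bound[of "max (real n) (2 / M)"] by simp
  qed
  then have "act x p = 0"
    using ip_self_eq_0 \<open>T = ip (act x p) (act x p)\<close> by simp
  then have "ip y x * p = 0" by (metis ip_act_right ip_zero_right)
  then have "st p * p = 0" by (simp add: p_def st_ip)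
  then show ?thesis by (simp add: st_mult_self_eq_0 p_def)
qed

lemma positive_ip_diff_if_orthogonal:
  assumes "ip x y = 0"
  shows "positive (ip (act x a + y) (act x a + y) - ip (act x a) (act x a))"
  using assms positive_ip_self ip_commute_eq_0[of x y] by (simp add: ip_translate)

lemma orthogonal_iff:
  "(\<forall>a. cle st (habs st ip (act x a) * habs st ip (act x a))
       (habs st ip (act x a + y) * habs st ip (act x a + y))) \<longleftrightarrow> ip x y = 0" (is "?i \<longleftrightarrow> ?o")
  "(\<forall>a. cle st (habs st ip (act x a)) (habs st ip (act x a + y))) \<longleftrightarrow> ip x y = 0" (is "?ii \<longleftrightarrow> _")
  "(\<forall>a. hnorm ip (act x a + y) \<ge> hnorm ip (act x a)) \<longleftrightarrow> ip x y = 0" (is "?iii \<longleftrightarrow> _")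
proof -
  have "?o \<Longrightarrow> ?i" "?o \<Longrightarrow> ?ii"
    using positive_ip_diff_if_orthogonal by (auto simp: cle_iff_positive habs intro: positive_sqrt_mono)
  moreover have "?i \<Longrightarrow> ?iii"
    using positive_norm_mono[OF positive_ip_self]
    by (simp add: cle_iff_positive habs hnorm_def)
  moreover have "?ii \<Longrightarrow> ?iii"
    using positive_norm_mono[OF habs(1)] by (metis cle_iff_positive norm_habs)
  moreover have "?iii \<Longrightarrow> ?o" by (rule orthogonal_if_hnorm_le) simp
  ultimately show "?i \<longleftrightarrow> ?o" "?ii \<longleftrightarrow> ?o" "?iii \<longleftrightarrow> ?o" by blast+
qed

end

theorem theorem2p4:
  fixes sc :: "complex \<Rightarrow> 'a::{real_normed_algebra,banach} \<Rightarrow> 'a"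
    and st :: "'a \<Rightarrow> 'a"
    and scX :: "complex \<Rightarrow> 'x::ab_group_add \<Rightarrow> 'x"
    and act :: "'x \<Rightarrow> 'a \<Rightarrow> 'x"
    and ip :: "'x \<Rightarrow> 'x \<Rightarrow> 'a"
    and x y :: 'x
  assumes "hilbert_module sc st scX act ip"
  shows "((\<forall>a. cle st (habs st ip (act x a) * habs st ip (act x a))
                     (habs st ip (act x a + y) * habs st ip (act x a + y))) \<longleftrightarrow> ip x y = 0)
       \<and> ((\<forall>a. cle st (habs st ip (act x a)) (habs st ip (act x a + y))) \<longleftrightarrow> ip x y = 0)
       \<and> ((\<forall>a. hnorm ip (act x a + y) \<ge> hnorm ip (act x a)) \<longleftrightarrow> ip x y = 0)
       \<and> ((\<forall>a. cle st (habs st ip (act y a) * habs st ip (act y a))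
                     (habs st ip (act y a + x) * habs st ip (act y a + x))) \<longleftrightarrow> ip x y = 0)
       \<and> ((\<forall>a. cle st (habs st ip (act y a)) (habs st ip (act y a + x))) \<longleftrightarrow> ip x y = 0)
       \<and> ((\<forall>a. hnorm ip (act y a + x) \<ge> hnorm ip (act y a)) \<longleftrightarrow> ip x y = 0)"
proof -
  interpret hilbert_cstar_module sc st scX act ip
    by unfold_locales (rule assms)
  show ?thesis
    \<comment> \<open>The last three conditions are the first three with x and y exchanged.\<close>
    unfolding orthogonal_iff ip_commute_eq_0[of y x] by blast
qed

end
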